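(* Let $X$ be a fuzzy topological space. If $\bigwedge_{A\in\Gamma}wcl(A)\neq0_X$ for every fuzzy filterbase $\Gamma$ in $X$, then $X$ is a fuzzy weakly-closed space.
   Context: Fuzzy topological spaces (FTS) are in Chang's sense: a fuzzy set in $X$ is a function $X\to[0,1]$, ordered pointwise by $\leq$, with $\vee,\wedge$ pointwise supremum and infimum and complement $A^c=1-A$; $0_X,1_X$ are the constant functions. A fuzzy topology $\tau$ on $X$ is a family of fuzzy sets containing $0_X,1_X$ and closed under finite $\wedge$ and arbitrary $\bigvee$; members of $\tau$ are fuzzy open and their complements fuzzy closed. $cl(A)$ is the infimum of all fuzzy closed sets $\geq A$ and $int(A)$ is the supremum of all fuzzy open sets $\leq A$. A fuzzy set $A$ is fuzzy semi-closed if $int(cl(A))\leq A$; a fuzzy set is fuzzy semi-open if its complement is fuzzy semi-closed. A fuzzy set $A$ is fuzzy weakly-closed if $cl(A)\leq U$ for every fuzzy semi-open set $U$ with $A\leq U$. A fuzzy set is fuzzy weakly-open if its complement is fuzzy weakly-closed. The fuzzy weakly-closure of $A$ is $wcl(A)=\bigwedge\{B\mid B\text{ is fuzzy weakly-closed and }A\leq B\}$. A collection $\Gamma$ of fuzzy sets in $X$ is a fuzzy filterbase if $\bigwedge_{j=1}^nA_j\neq0_X$ for every finite subcollection $\{A_1,\dots,A_n\}$ of $\Gamma$. The space $X$ is a fuzzy weakly-closed space if for every family $\{G_\lambda\mid\lambda\in\Lambda\}$ of fuzzy weakly-open sets with $\left(\bigvee_{\lambda\in\Lambda}G_\lambda\right)(x)=1$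 for every $x\in X$ there is a finite subfamily $G_{\lambda_1},\dots,G_{\lambda_n}$ with $\left(\bigvee_{i=1}^nwcl(G_{\lambda_i})\right)(x)=1$ for every $x\in X$. *)

theory Defs
  imports Complex_Main "HOL-Library.FuncSet"
begin

text \<open>
  The underlying set is an arbitrary carrier \<open>X\<close> (possibly empty). A fuzzy set in \<open>X\<close> is an
  extensional function from \<open>X\<close> to the real unit interval, so equality of fuzzy sets is equality
  of functions on \<open>X\<close>.
\<close>

definition fuzzy_sets :: "'a set \<Rightarrow> ('a \<Rightarrow> real) set" where
  "fuzzy_sets X = X \<rightarrow>\<^sub>E {0..1}"

definition fuzzy_le :: "'a set \<Rightarrow> ('a \<Rightarrow> real) \<Rightarrow> ('a \<Rightarrow> real) \<Rightarrow> bool" where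
  "fuzzy_le X A B \<longleftrightarrow> (\<forall>x\<in>X. A x \<le> B x)"

definition fuzzy_zero :: "'a set \<Rightarrow> 'a \<Rightarrow> real" where
  "fuzzy_zero X = (\<lambda>x\<in>X. 0)"

definition fuzzy_one :: "'a set \<Rightarrow> 'a \<Rightarrow> real" where
  "fuzzy_one X = (\<lambda>x\<in>X. 1)"

definition fuzzy_compl :: "'a set \<Rightarrow> ('a \<Rightarrow> real) \<Rightarrow> 'a \<Rightarrow> real" where
  "fuzzy_compl X A = (\<lambda>x\<in>X. 1 - A x)"

text \<open>
  Suprema and infima are taken in the lattice \<open>[0,1]\<close>. Inserting the bounds \<open>0\<close> and \<open>1\<close> only
  matters for the empty family, whose supremum is \<open>0\<^sub>X\<close> and whose infimum is \<open>1\<^sub>X\<close>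
  (on type \<^typ>\<open>real\<close> these would otherwise be unspecified).
\<close>

definition fuzzy_Sup :: "'a set \<Rightarrow> ('a \<Rightarrow> real) set \<Rightarrow> 'a \<Rightarrow> real" where
  "fuzzy_Sup X F = (\<lambda>x\<in>X. Sup (insert 0 ((\<lambda>A. A x) ` F)))"

definition fuzzy_Inf :: "'a set \<Rightarrow> ('a \<Rightarrow> real) set \<Rightarrow> 'a \<Rightarrow> real" where
  "fuzzy_Inf X F = (\<lambda>x\<in>X. Inf (insert 1 ((\<lambda>A. A x) ` F)))"

definition fuzzy_topology :: "'a set \<Rightarrow> ('a \<Rightarrow> real) set \<Rightarrow> bool" where
  "fuzzy_topology X \<tau> \<longleftrightarrow>
     \<tau> \<subseteq> fuzzy_sets X \<and>
     fuzzy_zero X \<in> \<tau> \<and> fuzzy_one X \<in> \<tau> \<and>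
     (\<forall>F. finite F \<and> F \<subseteq> \<tau> \<longrightarrow> fuzzy_Inf X F \<in> \<tau>) \<and>
     (\<forall>F. F \<subseteq> \<tau> \<longrightarrow> fuzzy_Sup X F \<in> \<tau>)"

definition fuzzy_open :: "('a \<Rightarrow> real) set \<Rightarrow> ('a \<Rightarrow> real) \<Rightarrow> bool" where
  "fuzzy_open \<tau> A \<longleftrightarrow> A \<in> \<tau>"

definition fuzzy_closed :: "'a set \<Rightarrow> ('a \<Rightarrow> real) set \<Rightarrow> ('a \<Rightarrow> real) \<Rightarrow> bool" where
  "fuzzy_closed X \<tau> A \<longleftrightarrow> A \<in> fuzzy_sets X \<and> fuzzy_open \<tau> (fuzzy_compl X A)"

definition fuzzy_cl :: "'a set \<Rightarrow> ('a \<Rightarrow> real) set \<Rightarrow> ('a \<Rightarrow> real) \<Rightarrow> 'a \<Rightarrow> real" where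
  "fuzzy_cl X \<tau> A = fuzzy_Inf X {B. fuzzy_closed X \<tau> B \<and> fuzzy_le X A B}"

definition fuzzy_int :: "'a set \<Rightarrow> ('a \<Rightarrow> real) set \<Rightarrow> ('a \<Rightarrow> real) \<Rightarrow> 'a \<Rightarrow> real" where
  "fuzzy_int X \<tau> A = fuzzy_Sup X {B. fuzzy_open \<tau> B \<and> fuzzy_le X B A}"

definition fuzzy_semi_closed :: "'a set \<Rightarrow> ('a \<Rightarrow> real) set \<Rightarrow> ('a \<Rightarrow> real) \<Rightarrow> bool" where
  "fuzzy_semi_closed X \<tau> A \<longleftrightarrow>
     A \<in> fuzzy_sets X \<and> fuzzy_le X (fuzzy_int X \<tau> (fuzzy_cl X \<tau> A)) A"

definition fuzzy_semi_open :: "'a set \<Rightarrow> ('a \<Rightarrow> real) set \<Rightarrow> ('a \<Rightarrow> real) \<Rightarrow> bool" where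
  "fuzzy_semi_open X \<tau> A \<longleftrightarrow>
     A \<in> fuzzy_sets X \<and> fuzzy_semi_closed X \<tau> (fuzzy_compl X A)"

definition fuzzy_weakly_closed :: "'a set \<Rightarrow> ('a \<Rightarrow> real) set \<Rightarrow> ('a \<Rightarrow> real) \<Rightarrow> bool" where
  "fuzzy_weakly_closed X \<tau> A \<longleftrightarrow>
     A \<in> fuzzy_sets X \<and>
     (\<forall>U. fuzzy_semi_open X \<tau> U \<and> fuzzy_le X A U \<longrightarrow> fuzzy_le X (fuzzy_cl X \<tau> A) U)"

definition fuzzy_weakly_open :: "'a set \<Rightarrow> ('a \<Rightarrow> real) set \<Rightarrow> ('a \<Rightarrow> real) \<Rightarrow> bool" where
  "fuzzy_weakly_open X \<tau> A \<longleftrightarrow>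
     A \<in> fuzzy_sets X \<and> fuzzy_weakly_closed X \<tau> (fuzzy_compl X A)"

definition fuzzy_wcl :: "'a set \<Rightarrow> ('a \<Rightarrow> real) set \<Rightarrow> ('a \<Rightarrow> real) \<Rightarrow> 'a \<Rightarrow> real" where
  "fuzzy_wcl X \<tau> A = fuzzy_Inf X {B. fuzzy_weakly_closed X \<tau> B \<and> fuzzy_le X A B}"

definition fuzzy_filterbase :: "'a set \<Rightarrow> ('a \<Rightarrow> real) set \<Rightarrow> bool" where
  "fuzzy_filterbase X \<Gamma> \<longleftrightarrow>
     \<Gamma> \<subseteq> fuzzy_sets X \<and>
     (\<forall>F. finite F \<and> F \<subseteq> \<Gamma> \<longrightarrow> fuzzy_Inf X F \<noteq> fuzzy_zero X)"

text \<open>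
  Families are represented by the sets of their members, on which alone the suprema depend.
  Finite subfamilies may be empty; this matters only for empty \<open>X\<close>.
\<close>

definition fuzzy_weakly_closed_space :: "'a set \<Rightarrow> ('a \<Rightarrow> real) set \<Rightarrow> bool" where
  "fuzzy_weakly_closed_space X \<tau> \<longleftrightarrow>
     (\<forall>\<G>. (\<forall>G\<in>\<G>. fuzzy_weakly_open X \<tau> G) \<and> (\<forall>x\<in>X. fuzzy_Sup X \<G> x = 1) \<longrightarrow>
        (\<exists>F. finite F \<and> F \<subseteq> \<G> \<and> (\<forall>x\<in>X. fuzzy_Sup X (fuzzy_wcl X \<tau> ` F) x = 1)))"

end

theory Submission
  imports Defs
begin

text \<open>
  If no finite subfamily of a weakly-open cover \<open>\<G>\<close> has weakly-closures covering \<open>X\<close>, then by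
  De Morgan the complements of these weakly-closures form a filterbase. For \<open>G \<in> \<G>\<close> the
  complement of \<open>wcl G\<close> lies below the weakly-closed set \<open>G\<^sup>c\<close>, and hence so does its weakly-closure.
  The infimum of these weakly-closures is therefore at most \<open>(\<Or>\<G>)\<^sup>c = 0\<close>.
\<close>

lemma fuzzy_sets_bounds:
  assumes "A \<in> fuzzy_sets X" "x \<in> X"
  shows "0 \<le> A x" "A x \<le> 1"
  using assms by (auto simp: fuzzy_sets_def PiE_iff)

lemma fuzzy_compl_in_sets: "A \<in> fuzzy_sets X \<Longrightarrow> fuzzy_compl X A \<in> fuzzy_sets X"
  by (auto simp: fuzzy_sets_def fuzzy_compl_def PiE_iff)

text \<open>The reals are only conditionally complete, so every use of \<open>cInf_lower\<close>
  needs this bound; membership in the unit interval supplies 0.\<close>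

lemma bdd_below_fuzzy_values:
  assumes "F \<subseteq> fuzzy_sets X" "x \<in> X"
  shows "bdd_below (insert 1 ((\<lambda>A. A x) ` F))"
  using assms by (auto intro!: bdd_belowI2[where m = 0] dest: fuzzy_sets_bounds)

lemma fuzzy_Inf_in_sets:
  assumes "F \<subseteq> fuzzy_sets X"
  shows "fuzzy_Inf X F \<in> fuzzy_sets X"
proof -
  have "0 \<le> Inf (insert 1 ((\<lambda>A. A x) ` F))" if "x \<in> X" for x
    using assms that by (intro cInf_greatest) (auto dest: fuzzy_sets_bounds)
  moreover have "Inf (insert 1 ((\<lambda>A. A x) ` F)) \<le> 1" if "x \<in> X" for x
    using bdd_below_fuzzy_values[OF assms that] by (intro cInf_lower) auto
  ultimately show ?thesis
    by (auto simp: fuzzy_sets_def fuzzy_Inf_def)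
qed

lemma fuzzy_Inf_lower:
  assumes "F \<subseteq> fuzzy_sets X" "A \<in> F"
  shows "fuzzy_le X (fuzzy_Inf X F) A"
  using bdd_below_fuzzy_values[OF assms(1)] assms(2)
  by (auto simp: fuzzy_le_def fuzzy_Inf_def intro!: cInf_lower)

lemma fuzzy_Inf_greatest:
  assumes "A \<in> fuzzy_sets X" "\<And>B. B \<in> F \<Longrightarrow> fuzzy_le X A B"
  shows "fuzzy_le X A (fuzzy_Inf X F)"
  unfolding fuzzy_le_def
proof
  fix x assume "x \<in> X"
  \<comment> \<open>The inserted bound 1 must dominate \<open>A x\<close> as well; this is where
    \<open>A\<close> being a fuzzy set enters.\<close>
  then have "A x \<le> Inf (insert 1 ((\<lambda>A. A x) ` F))"
    using assms by (intro cInf_greatest) (auto simp: fuzzy_le_def dest: fuzzy_sets_bounds)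
  with \<open>x \<in> X\<close> show "A x \<le> fuzzy_Inf X F x"
    by (simp add: fuzzy_Inf_def)
qed

text \<open>De Morgan's law: the map sending v to 1 - v reverses the order of the unit interval, so
  it carries the least upper bound at each point to the greatest lower bound.\<close>

lemma fuzzy_Inf_compl:
  assumes "F \<subseteq> fuzzy_sets X"
  shows "fuzzy_Inf X (fuzzy_compl X ` F) = fuzzy_compl X (fuzzy_Sup X F)"
proof
  fix x
  show "fuzzy_Inf X (fuzzy_compl X ` F) x = fuzzy_compl X (fuzzy_Sup X F) x"
  proof (cases "x \<in> X")
    case True
    let ?V = "insert 0 ((\<lambda>A. A x) ` F)"
    have bdd: "bdd_above ?V"
      using assms True by (auto intro!: bdd_aboveI2[where M = 1] dest: fuzzy_sets_bounds)
    have "Inf ((\<lambda>v. 1 - v) ` ?V) = 1 - Sup ?V"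
    proof (rule cInf_eq_non_empty)
      fix y assume y: "\<And>w. w \<in> (\<lambda>v. 1 - v) ` ?V \<Longrightarrow> y \<le> w"
      have "Sup ?V \<le> 1 - y"
      proof (rule cSup_least)
        fix v assume "v \<in> ?V"
        with y[of "1 - v"] show "v \<le> 1 - y" by fastforce
      qed simp
      then show "y \<le> 1 - Sup ?V" by simp
    next
      fix w assume "w \<in> (\<lambda>v. 1 - v) ` ?V"
      with cSup_upper[OF _ bdd] show "1 - Sup ?V \<le> w" by fastforce
    qed simp
    \<comment> \<open>The reflection exchanges the two default bounds 0 and 1, so the empty family
      needs no separate case.\<close>
    moreover have "(\<lambda>v. 1 - v) ` ?V = insert 1 ((\<lambda>A. A x) ` fuzzy_compl X ` F)"
      using True by (simp add: image_image fuzzy_compl_def)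
    ultimately show ?thesis
      using True by (simp add: fuzzy_Inf_def fuzzy_compl_def fuzzy_Sup_def)
  qed (simp add: fuzzy_Inf_def fuzzy_compl_def)
qed

text \<open>Translates between covering \<open>X\<close> and having a vanishing complement, both for
  the given cover and for its finite subfamilies.\<close>

lemma fuzzy_compl_eq_zero_iff: "fuzzy_compl X A = fuzzy_zero X \<longleftrightarrow> (\<forall>x\<in>X. A x = 1)"
proof
  assume eq: "fuzzy_compl X A = fuzzy_zero X"
  show "\<forall>x\<in>X. A x = 1"
  proof
    fix x assume "x \<in> X"
    with fun_cong[OF eq, of x] show "A x = 1"
      by (simp add: fuzzy_compl_def fuzzy_zero_def)
  qed
qed (auto simp: fuzzy_compl_def fuzzy_zero_def intro: restrict_ext)

lemma fuzzy_le_zero_eq: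
  assumes "A \<in> fuzzy_sets X" "fuzzy_le X A (fuzzy_zero X)"
  shows "A = fuzzy_zero X"
proof
  fix x show "A x = fuzzy_zero X x"
    \<comment> \<open>On \<open>X\<close> the values are squeezed between 0 and 0; off
      \<open>X\<close> both functions are \<open>undefined\<close> by extensionality.\<close>
    using assms fuzzy_sets_bounds[OF assms(1), of x]
    by (cases "x \<in> X") (force simp: fuzzy_le_def fuzzy_zero_def fuzzy_sets_def)+
qed

lemma fuzzy_wcl_in_sets: "fuzzy_wcl X \<tau> A \<in> fuzzy_sets X"
  unfolding fuzzy_wcl_def by (rule fuzzy_Inf_in_sets) (auto simp: fuzzy_weakly_closed_def)

lemma fuzzy_wcl_extensive: "A \<in> fuzzy_sets X \<Longrightarrow> fuzzy_le X A (fuzzy_wcl X \<tau> A)"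
  unfolding fuzzy_wcl_def by (rule fuzzy_Inf_greatest) auto

lemma fuzzy_wcl_minimal:
  assumes "fuzzy_weakly_closed X \<tau> B" "fuzzy_le X A B"
  shows "fuzzy_le X (fuzzy_wcl X \<tau> A) B"
  unfolding fuzzy_wcl_def
  by (rule fuzzy_Inf_lower) (use assms in \<open>auto simp: fuzzy_weakly_closed_def\<close>)

text \<open>Complementing \<open>G\<close> \<le> \<open>wcl G\<close> reverses the inequality, so
  the weakly-closed complement of \<open>G\<close> is one of the sets over which the outer closure
  takes its infimum.\<close>

lemma fuzzy_wcl_compl_wcl_le:
  assumes "fuzzy_weakly_open X \<tau> G"
  shows "fuzzy_le X (fuzzy_wcl X \<tau> (fuzzy_compl X (fuzzy_wcl X \<tau> G))) (fuzzy_compl X G)"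
proof (rule fuzzy_wcl_minimal)
  show "fuzzy_weakly_closed X \<tau> (fuzzy_compl X G)"
    using assms by (simp add: fuzzy_weakly_open_def)
  show "fuzzy_le X (fuzzy_compl X (fuzzy_wcl X \<tau> G)) (fuzzy_compl X G)"
    using assms fuzzy_wcl_extensive[of G X \<tau>]
    by (simp add: fuzzy_weakly_open_def fuzzy_le_def fuzzy_compl_def)
qed

theorem theorem4p13:
  fixes X :: "'a set" and \<tau> :: "('a \<Rightarrow> real) set"
  assumes "fuzzy_topology X \<tau>"
    and "\<And>\<Gamma>. fuzzy_filterbase X \<Gamma> \<Longrightarrow> fuzzy_Inf X (fuzzy_wcl X \<tau> ` \<Gamma>) \<noteq> fuzzy_zero X"
  shows "fuzzy_weakly_closed_space X \<tau>"
  unfolding fuzzy_weakly_closed_space_def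
proof (intro allI impI, elim conjE)
  fix \<G>
  assume op: "\<forall>G\<in>\<G>. fuzzy_weakly_open X \<tau> G" and cover: "\<forall>x\<in>X. fuzzy_Sup X \<G> x = 1"
  have \<G>: "\<G> \<subseteq> fuzzy_sets X"
    using op by (auto simp: fuzzy_weakly_open_def)
  show "\<exists>F. finite F \<and> F \<subseteq> \<G> \<and> (\<forall>x\<in>X. fuzzy_Sup X (fuzzy_wcl X \<tau> ` F) x = 1)"
  proof (rule ccontr)
    assume no_subcover: "\<not> ?thesis"
    define \<Gamma> where "\<Gamma> = (\<lambda>G. fuzzy_compl X (fuzzy_wcl X \<tau> G)) ` \<G>"
    have "fuzzy_filterbase X \<Gamma>"
      unfolding fuzzy_filterbase_def
    proof (intro conjI allI impI; (elim conjE)?)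
      show "\<Gamma> \<subseteq> fuzzy_sets X"
        by (auto simp: \<Gamma>_def intro: fuzzy_compl_in_sets fuzzy_wcl_in_sets)
    next
      fix F assume "finite F" "F \<subseteq> \<Gamma>"
      \<comment> \<open>A finite part of an image is the image of a finite part; choosing such a
        preimage in \<G> lets \<open>no_subcover\<close> apply.\<close>
      then obtain F' where F': "finite F'" "F' \<subseteq> \<G>"
        and "F = (\<lambda>G. fuzzy_compl X (fuzzy_wcl X \<tau> G)) ` F'"
        using finite_subset_image[of F] unfolding \<Gamma>_def by metis
      then have F: "F = fuzzy_compl X ` fuzzy_wcl X \<tau> ` F'"
        by (simp add: image_image)
      have "fuzzy_Inf X F = fuzzy_compl X (fuzzy_Sup X (fuzzy_wcl X \<tau> ` F'))"
        unfolding F by (rule fuzzy_Inf_compl) (auto intro: fuzzy_wcl_in_sets)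
      with no_subcover F' show "fuzzy_Inf X F \<noteq> fuzzy_zero X"
        by (auto simp: fuzzy_compl_eq_zero_iff)
    qed
    then have nonzero: "fuzzy_Inf X (fuzzy_wcl X \<tau> ` \<Gamma>) \<noteq> fuzzy_zero X"
      by (rule assms(2))
    have sets: "fuzzy_wcl X \<tau> ` \<Gamma> \<subseteq> fuzzy_sets X"
      by (auto intro: fuzzy_wcl_in_sets)
    have "fuzzy_le X (fuzzy_Inf X (fuzzy_wcl X \<tau> ` \<Gamma>)) (fuzzy_Inf X (fuzzy_compl X ` \<G>))"
    proof (rule fuzzy_Inf_greatest[OF fuzzy_Inf_in_sets[OF sets]])
      fix B assume "B \<in> fuzzy_compl X ` \<G>"
      then obtain G where G: "G \<in> \<G>" "B = fuzzy_compl X G" by blast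
      have "fuzzy_le X (fuzzy_Inf X (fuzzy_wcl X \<tau> ` \<Gamma>))
          (fuzzy_wcl X \<tau> (fuzzy_compl X (fuzzy_wcl X \<tau> G)))"
        by (rule fuzzy_Inf_lower[OF sets]) (use G in \<open>auto simp: \<Gamma>_def\<close>)
      with fuzzy_wcl_compl_wcl_le[of X \<tau> G] G op
      show "fuzzy_le X (fuzzy_Inf X (fuzzy_wcl X \<tau> ` \<Gamma>)) B"
        by (auto simp: fuzzy_le_def intro: order_trans)
    qed
    \<comment> \<open>By De Morgan this infimum is the complement of the supremum of the cover,
      which is constantly 1 on \<open>X\<close>.\<close>
    also have "fuzzy_Inf X (fuzzy_compl X ` \<G>) = fuzzy_zero X"
      using cover by (simp add: fuzzy_Inf_compl[OF \<G>] fuzzy_compl_eq_zero_iff)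
    finally show False
      using nonzero fuzzy_le_zero_eq fuzzy_Inf_in_sets[OF sets] by blast
  qed
qed

end
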